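(* Let $p\in\mathbb{N}_0$ and $k\in\mathbb{N}$. There exists a constant $N_{p,k}>0$, depending only on $p$ and $k$, such that for every $f\in C_p[0,\infty)$, every $n\in\mathbb{N}$ with $p+2\le n-k$, and every $x\in(0,\infty)$, $$w_p(x)\,|M_{n,k}(f;x)-f(x)|\le N_{p,k}\,\omega_p^2\!\left(f;\frac{x}{\sqrt n}\right)+\omega_p^1\!\left(f;\frac{|1-k|}{n}x\right).$$ Furthermore, if $f\in Lip_p^2\alpha$ for some $\alpha\in(0,2]$, then there exists a constant $N>0$ (which may depend on $p$, $k$, $\alpha$ and $f$, but not on $n$ or $x$) such that for every $n\in\mathbb{N}$ with $p+2\le n-k$ and every $x\in(0,\infty)$, $$w_p(x)\,|M_{n,k}(f;x)-f(x)|\le N\left(\frac{x^2}{n}\right)^{\alpha/2}+\omega_p^1\!\left(f;\frac{|1-k|}{n}x\right).$$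
   Context: $\mathbb{N}=\{1,2,\dots\}$, $\mathbb{N}_0=\mathbb{N}\cup\{0\}$. For $n,k\in\mathbb{N}$ with $k\le n$ and $x>0$, the general Gamma type operator is $$M_{n,k}(f;x)=\frac{(2n-k+1)!\,x^{n+1}}{n!\,(n-k)!}\int_0^\infty\frac{t^{n-k}}{(x+t)^{2n-k+2}}f(t)\,dt.$$ Weights: $w_0(x)=1$ and $w_p(x)=\frac{1}{1+x^p}$ for $p\ge1$, $x\ge0$. $C_p=C_p[0,\infty)$ is the set of all real-valued functions $f$ on $[0,\infty)$ such that $w_pf$ is bounded and uniformly continuous on $[0,\infty)$, with norm $\|f\|_p=\sup_{x\in[0,\infty)}w_p(x)|f(x)|$. For $h>0$, $\Delta_h^2f(x)=f(x+2h)-2f(x+h)+f(x)$. For $\delta>0$, $\omega_p^2(f;\delta)=\sup_{h\in(0,\delta]}\|\Delta_h^2f\|_p$. For $\delta\ge0$, $\omega_p^1(f;\delta)=\sup\{w_p(x)|f(t)-f(x)|:\ |t-x|\le\delta,\ t,x\ge0\}$. For $\alpha\in(0,2]$, $Lip_p^2\alpha=\{f\in C_p[0,\infty):\ \omega_p^2(f;\delta)=O(\delta^\alpha)\text{ as }\delta\to0^+\}$. *)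

theory Defs
  imports "HOL-Analysis.Analysis" "HOL-Library.Landau_Symbols"
begin

text \<open>
  Functions on \<open>[0,\<infinity>)\<close> are represented by total functions on the reals; every notion below only
  looks at their values on \<open>{0..}\<close>.
\<close>

definition weight :: "nat \<Rightarrow> real \<Rightarrow> real" where
  "weight p x = (if p = 0 then 1 else 1 / (1 + x ^ p))"

definition weighted_C :: "nat \<Rightarrow> (real \<Rightarrow> real) set" where
  "weighted_C p = {f. bounded ((\<lambda>x. weight p x * f x) ` {0..}) \<and>
                      uniformly_continuous_on {0..} (\<lambda>x. weight p x * f x)}"

text \<open>
  The suprema below are real-valued, hence meaningful only for bounded families. For
  \<open>f \<in> weighted_C p\<close> all of them are bounded, because \<open>(1 + (x + h) ^ p) / (1 + x ^ p)\<close> is bounded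
  over \<open>x \<ge> 0\<close> and \<open>h\<close> in a bounded set.
\<close>

definition weighted_norm :: "nat \<Rightarrow> (real \<Rightarrow> real) \<Rightarrow> real" where
  "weighted_norm p f = (SUP x\<in>{0..}. weight p x * \<bar>f x\<bar>)"

definition second_difference :: "real \<Rightarrow> (real \<Rightarrow> real) \<Rightarrow> real \<Rightarrow> real" where
  "second_difference h f x = f (x + 2 * h) - 2 * f (x + h) + f x"

definition modulus2 :: "nat \<Rightarrow> (real \<Rightarrow> real) \<Rightarrow> real \<Rightarrow> real" where
  "modulus2 p f \<delta> = (SUP h\<in>{0<..\<delta>}. weighted_norm p (second_difference h f))"

definition modulus1 :: "nat \<Rightarrow> (real \<Rightarrow> real) \<Rightarrow> real \<Rightarrow> real" where
  "modulus1 p f \<delta> =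
     Sup {weight p x * \<bar>f t - f x\<bar> | t x. \<bar>t - x\<bar> \<le> \<delta> \<and> t \<ge> 0 \<and> x \<ge> 0}"

definition Lip2 :: "nat \<Rightarrow> real \<Rightarrow> (real \<Rightarrow> real) set" where
  "Lip2 p \<alpha> = {f \<in> weighted_C p. modulus2 p f \<in> O[at_right 0](\<lambda>\<delta>. \<delta> powr \<alpha>)}"

text \<open>
  Intended for \<open>1 \<le> k \<le> n\<close> and \<open>x > 0\<close>, so the natural-number subtractions do not truncate.
  For \<open>f \<in> weighted_C p\<close> with \<open>p \<le> n\<close> the integrand is Lebesgue integrable, since it is
  \<open>O(t powr (p - n - 2))\<close> at infinity.
\<close>

definition gamma_operator :: "nat \<Rightarrow> nat \<Rightarrow> (real \<Rightarrow> real) \<Rightarrow> real \<Rightarrow> real" where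
  "gamma_operator n k f x =
     fact (2 * n - k + 1) * x ^ (n + 1) / (fact n * fact (n - k)) *
     (LBINT t:{0..}. t ^ (n - k) / (x + t) ^ (2 * n - k + 2) * f t)"

end

theory Submission
  imports Defs
begin

text \<open>
  The operator \<open>f \<mapsto> M\<^sub>n\<^sub>,\<^sub>k(f;x)\<close> is the expectation of \<open>f\<close> under a probability measure on
  \<open>[0,\<infinity>)\<close> whose \<open>m\<close>-th moment is an explicit quotient of factorials times \<open>x ^ m\<close>. Its mean is
  \<open>e = x (n - k + 1) / n\<close>, which lies at distance \<open>\<bar>1 - k\<bar> x / n\<close> from \<open>x\<close>, and it is
  concentrated around \<open>e\<close> on the scale \<open>h = x / sqrt n\<close>. Replacing \<open>f x\<close> by \<open>f e\<close> costs
  the first modulus of continuity, so what remains is to bound the distance of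
  \<open>M\<^sub>n\<^sub>,\<^sub>k(f;x)\<close> from \<open>f e\<close> by the second modulus at \<open>h\<close>.

  The usual way to do this is to smooth \<open>f\<close> by Steklov means and to expand the smooth function to
  second order. The proof below expands \<open>f\<close> itself. Let \<open>A\<close> be the slope of the chord of \<open>f\<close> over
  \<open>[e, e + h]\<close>. Then \<open>f t - f e - A (t - e)\<close> has the same second differences as \<open>f\<close> and
  vanishes at \<open>e\<close> and \<open>e + h\<close>. A continuous function that vanishes at both ends of an interval is
  bounded there by its second differences, and a sequence with bounded second differences
  grows at most quadratically; walking from \<open>e\<close> to \<open>t\<close> in equal steps of length at most \<open>h\<close> gives
  a bound by a multiple of \<open>1 + ((t - e) / h)\<^sup>2\<close> times the size of the second differences
  (lemma \<open>second_difference_taylor\<close>). The linear term \<open>A (t - e)\<close> has expectation zero, however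
  large \<open>A\<close> is. So the error is at most a constant times the second modulus times the expectation of
  \<open>(1 + ((t - e) / h)\<^sup>2) (1 + t ^ p)\<close> and of the same expression with \<open>x\<close> in the last factor.
  Because the variance is at most of order \<open>h\<^sup>2\<close>, also when weighted by \<open>t ^ p\<close>, these expectations are
  at most a constant times \<open>1 + x ^ p\<close>, and the weight at \<open>x\<close> cancels this factor
  (lemmas \<open>gamma_measure_spread\<close> and \<open>gamma_operator_sub_mean_le\<close>).

  For Lipschitz functions the second modulus is controlled only near \<open>0\<close>, and for large arguments
  it may grow faster than the required power. When \<open>x / sqrt n\<close> is bounded below, however, the
  required bound is bounded below as well, and the weighted error is bounded uniformly in \<open>n\<close> and
  \<open>x\<close> (lemma \<open>gamma_operator_error_bounded\<close>), which covers these arguments.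
\<close>

section \<open>Functions with bounded second differences\<close>

text \<open>
  At a point \<open>c\<close> where \<open>\<bar>D\<bar>\<close> is largest, reflect the nearer end of the interval in \<open>c\<close>: the
  second difference centred at \<open>c\<close> has one outer value \<open>0\<close> and the other at most \<open>\<bar>D c\<bar>\<close>, so
  \<open>2 \<bar>D c\<bar> \<le> E + \<bar>D c\<bar>\<close>.
\<close>

lemma abs_le_second_difference_bound:
  fixes D :: "real \<Rightarrow> real"
  assumes cont: "continuous_on {a..b} D" and zeros: "D a = 0" "D b = 0"
    and E: "0 \<le> E"
    and diff: "\<And>y s. 0 < s \<Longrightarrow> a \<le> y \<Longrightarrow> y + 2 * s \<le> b \<Longrightarrow> \<bar>second_difference s D y\<bar> \<le> E"
    and t: "t \<in> {a..b}"
  shows "\<bar>D t\<bar> \<le> E"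
proof -
  have "continuous_on {a..b} (\<lambda>x. \<bar>D x\<bar>)" using cont by (intro continuous_intros)
  then obtain c where c: "c \<in> {a..b}" and max: "\<And>y. y \<in> {a..b} \<Longrightarrow> \<bar>D y\<bar> \<le> \<bar>D c\<bar>"
    using continuous_attains_sup[of "{a..b}" "\<lambda>x. \<bar>D x\<bar>"] t by auto
  have "\<bar>D c\<bar> \<le> E"
  proof (cases "c = a \<or> c = b")
    case True
    then show ?thesis using zeros E by auto
  next
    case False
    then have ab: "a < c" "c < b" using c by auto
    show ?thesis
    proof (cases "c - a \<le> b - c")
      case True
      have "\<bar>second_difference (c - a) D a\<bar> \<le> E" using ab True by (intro diff) auto
      moreover have "\<bar>D (a + 2 * (c - a))\<bar> \<le> \<bar>D c\<bar>" using ab True by (intro max) auto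
      ultimately show ?thesis using zeros by (simp add: second_difference_def)
    next
      case False
      have "\<bar>second_difference (b - c) D (2 * c - b)\<bar> \<le> E" using ab False by (intro diff) auto
      moreover have "\<bar>D (2 * c - b)\<bar> \<le> \<bar>D c\<bar>" using ab False by (intro max) auto
      moreover have "2 * c - b + 2 * (b - c) = b" "2 * c - b + (b - c) = c" by auto
      ultimately show ?thesis using zeros by (simp add: second_difference_def)
    qed
  qed
  with max[OF t] show ?thesis by linarith
qed

lemma quadratic_growth_of_sequence:
  fixes d :: "nat \<Rightarrow> real"
  assumes "d 0 = 0" "\<bar>d 1\<bar> \<le> F" "0 \<le> F"
    and diff: "\<And>j. j + 2 \<le> m \<Longrightarrow> \<bar>d (j + 2) - 2 * d (j + 1) + d j\<bar> \<le> F"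
  shows "\<bar>d m\<bar> \<le> (real m)\<^sup>2 * F"
proof -
  have step: "j < m \<Longrightarrow> \<bar>d (j + 1) - d j\<bar> \<le> real (j + 1) * F" for j
  proof (induction j)
    case 0
    then show ?case using assms by simp
  next
    case (Suc j)
    then have "\<bar>d (j + 1) - d j\<bar> \<le> real (j + 1) * F" by simp
    moreover have "\<bar>d (j + 2) - 2 * d (j + 1) + d j\<bar> \<le> F" using Suc.prems by (intro diff) simp
    ultimately show ?case by (simp add: algebra_simps)
  qed
  have "j \<le> m \<Longrightarrow> \<bar>d j\<bar> \<le> (real j)\<^sup>2 * F" for j
  proof (induction j)
    case 0
    then show ?case using assms by simp
  next
    case (Suc j)
    have "(real j)\<^sup>2 * F + real (j + 1) * F \<le> (real (Suc j))\<^sup>2 * F"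
      using \<open>0 \<le> F\<close> by (simp add: power2_eq_square algebra_simps)
    moreover have "\<bar>d j\<bar> \<le> (real j)\<^sup>2 * F" "\<bar>d (j + 1) - d j\<bar> \<le> real (j + 1) * F"
      using Suc step[of j] by auto
    ultimately show ?case by (simp add: abs_le_iff)
  qed
  then show ?thesis by simp
qed

text \<open>
  A second-order Taylor estimate in which the derivative at \<open>e\<close> is replaced by the slope of a chord
  and the second derivative by second differences with steps up to \<open>h\<close>. The function \<open>W\<close>
  is nondecreasing, so that its values at \<open>t\<close> and \<open>e + h\<close> together dominate all second differences that
  occur, on either side of \<open>e\<close>.
\<close>

lemma second_difference_taylor:
  fixes f W :: "real \<Rightarrow> real"
  assumes cont: "continuous_on {0..} f" and h: "0 < h" and e: "0 \<le> e" and t: "0 \<le> t"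
    and W: "\<And>y. 0 \<le> y \<Longrightarrow> 0 \<le> W y" "\<And>y z. 0 \<le> y \<Longrightarrow> y \<le> z \<Longrightarrow> W y \<le> W z"
    and diff: "\<And>s y. 0 < s \<Longrightarrow> s \<le> h \<Longrightarrow> 0 \<le> y \<Longrightarrow> \<bar>second_difference s f y\<bar> \<le> W y"
  shows "\<bar>f t - f e - (f (e + h) - f e) / h * (t - e)\<bar>
           \<le> 4 * (1 + ((t - e) / h)\<^sup>2) * (W t + W (e + h))"
proof -
  \<comment> \<open>Subtracting the chord leaves second differences unchanged and creates zeros at \<open>e\<close>, \<open>e + h\<close>.\<close>
  define A where "A = (f (e + h) - f e) / h"
  define D where "D = (\<lambda>y. f y - f e - A * (y - e))"
  define E where "E = W t + W (e + h)"
  have E: "0 \<le> E" using W t e h by (simp add: E_def)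
  have D0: "D e = 0" "D (e + h) = 0" using h by (auto simp: D_def A_def)
  have D2: "second_difference s D y = second_difference s f y" for s y
    unfolding second_difference_def D_def by (simp add: algebra_simps)
  have bound: "\<bar>second_difference s D y\<bar> \<le> E"
    if "0 < s" "s \<le> h" "0 \<le> y" "y \<le> max t (e + h)" for s y
  proof -
    have "\<bar>second_difference s f y\<bar> \<le> W y" using diff that by simp
    also have "\<dots> \<le> E"
    proof (cases "y \<le> t")
      case True
      then show ?thesis using W(2)[of y t] W(1)[of "e + h"] that e h by (simp add: E_def)
    next
      case False
      then have "y \<le> e + h" using that by (simp add: max_def split: if_splits)
      then show ?thesis using W(2)[of y "e + h"] W(1)[of t] that t by (simp add: E_def)
    qed
    finally show ?thesis by (simp add: D2)
  qed
  have local: "\<bar>D (e + s)\<bar> \<le> E" if s: "0 \<le> s" "s \<le> h" for s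
  proof (rule abs_le_second_difference_bound[of e "e + h" D E "e + s"])
    show "continuous_on {e..e + h} D" unfolding D_def
      using e by (intro continuous_intros continuous_on_subset[OF cont]) auto
    show "\<bar>second_difference s D y\<bar> \<le> E" if "0 < s" "e \<le> y" "y + 2 * s \<le> e + h" for y s
      using that e by (intro bound) auto
  qed (use s D0 E in auto)
  have "\<bar>D t\<bar> \<le> 4 * (1 + ((t - e) / h)\<^sup>2) * E"
  proof (cases "t = e")
    case True
    then show ?thesis using D0 E by simp
  next
    case False
    \<comment> \<open>\<open>m\<close> is the least number of equal steps from \<open>e\<close> to \<open>t\<close> of length at most \<open>h\<close>.\<close>
    define u where "u = \<bar>t - e\<bar> / h"
    define m where "m = nat \<lceil>u\<rceil>"
    define s where "s = \<bar>t - e\<bar> / real m"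
    have u: "0 < u" using False h by (simp add: u_def)
    have m: "u \<le> real m" "real m \<le> u + 1" "0 < m" using u by (auto simp: m_def)
    have s: "0 < s" "s \<le> h" "real m * s = \<bar>t - e\<bar>"
      using m False h by (auto simp: s_def u_def field_simps)
    have "\<bar>D t\<bar> \<le> (real m)\<^sup>2 * (2 * E)"
    proof (cases "e < t")
      case True
      have "\<bar>D (e + real m * s)\<bar> \<le> (real m)\<^sup>2 * (2 * E)"
      proof (rule quadratic_growth_of_sequence[of "\<lambda>j. D (e + real j * s)"])
        show "\<bar>D (e + real 1 * s)\<bar> \<le> 2 * E" using local[of s] s E by simp
        fix j assume "j + 2 \<le> m"
        then have "real j * s \<le> real m * s" using s(1) by simp
        then have "\<bar>second_difference s D (e + real j * s)\<bar> \<le> E"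
          using s e True by (intro bound) auto
        then show "\<bar>D (e + real (j + 2) * s) - 2 * D (e + real (j + 1) * s) + D (e + real j * s)\<bar>
                     \<le> 2 * E"
          using E by (simp add: second_difference_def algebra_simps)
      qed (use D0 E in auto)
      then show ?thesis using s True by simp
    next
      case False
      have low: "t \<le> e - real j * s" if "j \<le> m" for j
        using that s False mult_right_mono[of "real j" "real m" s] by simp
      have "\<bar>D (e - real m * s)\<bar> \<le> (real m)\<^sup>2 * (2 * E)"
      proof (rule quadratic_growth_of_sequence[of "\<lambda>j. D (e - real j * s)"])
        \<comment> \<open>The first step to the left is compared with its mirror image in \<open>[e, e + h]\<close>.\<close>
        have "\<bar>second_difference s D (e - s)\<bar> \<le> E"
          using s h e t low[of 1] m by (intro bound) auto
        then have "\<bar>D (e + s) - 2 * D e + D (e - s)\<bar> \<le> E"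
          by (simp add: second_difference_def add.commute)
        moreover have "\<bar>D (e + s)\<bar> \<le> E" using s by (intro local) auto
        ultimately have "\<bar>D (e - s)\<bar> \<le> 2 * E" using D0(1) by linarith
        then show "\<bar>D (e - real 1 * s)\<bar> \<le> 2 * E" by simp
        fix j assume j: "j + 2 \<le> m"
        have "0 \<le> real (j + 2) * s" using s by simp
        then have "e - real (j + 2) * s \<le> max t (e + h)"
          using h unfolding le_max_iff_disj by linarith
        then have "\<bar>second_difference s D (e - real (j + 2) * s)\<bar> \<le> E"
          using low[OF j] t by (intro bound[OF s(1,2)]) linarith+
        moreover have "e - real (j + 2) * s + 2 * s = e - real j * s"
          "e - real (j + 2) * s + s = e - real (j + 1) * s" by (simp_all add: algebra_simps)
        ultimately show "\<bar>D (e - real (j + 2) * s) - 2 * D (e - real (j + 1) * s) + D (e - real j * s)\<bar>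
                     \<le> 2 * E"
          using E unfolding second_difference_def by (simp add: algebra_simps)
      qed (use D0 E in auto)
      then show ?thesis using s False by simp
    qed
    also have "\<dots> \<le> (2 * (1 + u\<^sup>2)) * (2 * E)"
    proof (rule mult_right_mono)
      have "(real m)\<^sup>2 \<le> (u + 1)\<^sup>2" using m by (intro power_mono) auto
      also have "\<dots> \<le> 2 * (1 + u\<^sup>2)" using zero_le_power2[of "u - 1"]
        by (simp add: power2_eq_square algebra_simps)
      finally show "(real m)\<^sup>2 \<le> 2 * (1 + u\<^sup>2)" .
    qed (use E in auto)
    also have "u\<^sup>2 = ((t - e) / h)\<^sup>2" by (simp add: u_def power_divide)
    finally show ?thesis by (simp add: algebra_simps)
  qed
  then show ?thesis by (simp add: D_def E_def A_def)
qed

section \<open>Weights and weighted moduli\<close>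

lemma weight_pos: "0 \<le> x \<Longrightarrow> 0 < weight p x"
  by (auto simp: weight_def add_pos_nonneg)

text \<open>
  Up to the factor 2, which is attained for \<open>p = 0\<close>, the reciprocal of the weight is \<open>1 + x ^ p\<close>.
  Working with this polynomial treats all \<open>p\<close> alike and reduces expectations to moments.
\<close>

lemma weight_power_bounds:
  assumes "0 \<le> x"
  shows "1 \<le> weight p x * (1 + x ^ p)" "weight p x * (1 + x ^ p) \<le> 2"
  using assms add_pos_nonneg[of 1 "x ^ p"] by (auto simp: weight_def)

lemma power_shift_le:
  fixes y c :: real
  assumes "0 \<le> y" "0 \<le> c" "0 \<le> t" "t \<le> y + c"
  shows "1 + t ^ p \<le> 2 * (1 + c) ^ p * (1 + y ^ p)"
proof -
  have "y + c \<le> (1 + c) * max 1 y"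
  proof (cases "y \<le> 1")
    case False
    then have "c * 1 \<le> c * y" using assms by (intro mult_left_mono) auto
    then show ?thesis using False by (simp add: algebra_simps)
  qed (use assms in auto)
  then have "t ^ p \<le> ((1 + c) * max 1 y) ^ p" using assms by (intro power_mono) auto
  also have "\<dots> = (1 + c) ^ p * max 1 y ^ p" by (simp add: power_mult_distrib)
  also have "\<dots> \<le> (1 + c) ^ p * (1 + y ^ p)"
    using assms by (intro mult_left_mono) (auto simp: max_def)
  finally have "t ^ p \<le> (1 + c) ^ p * (1 + y ^ p)" .
  moreover have "1 * 1 \<le> (1 + c) ^ p * (1 + y ^ p)"
    using assms by (intro mult_mono) auto
  ultimately show ?thesis by simp
qed

lemma weighted_C_continuous:
  assumes "f \<in> weighted_C p"
  shows "continuous_on {0..} f"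
proof -
  have "continuous_on {0..} (\<lambda>x. weight p x * f x)"
    using assms by (simp add: weighted_C_def uniformly_continuous_imp_continuous)
  moreover have "continuous_on {0..} (\<lambda>x. 1 / weight p x)"
    unfolding weight_def by (cases "p = 0") (auto intro!: continuous_intros)
  ultimately have "continuous_on {0..} (\<lambda>x. (weight p x * f x) * (1 / weight p x))"
    by (rule continuous_on_mult)
  then show ?thesis
    by (rule continuous_on_cong[THEN iffD1, rotated -1]) (use weight_pos[of _ p] in force)+
qed

lemma weighted_C_growth:
  assumes "f \<in> weighted_C p"
  obtains B where "0 \<le> B" "\<And>y. 0 \<le> y \<Longrightarrow> \<bar>f y\<bar> \<le> B * (1 + y ^ p)"
proof -
  obtain B where B: "\<And>y. 0 \<le> y \<Longrightarrow> \<bar>weight p y * f y\<bar> \<le> B"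
    using assms by (auto simp: weighted_C_def bounded_iff)
  show thesis
  proof
    show "0 \<le> B" using B[of 0] by simp
    fix y :: real assume y: "0 \<le> y"
    have "\<bar>f y\<bar> * 1 \<le> \<bar>f y\<bar> * (weight p y * (1 + y ^ p))"
      using weight_power_bounds[OF y] by (intro mult_left_mono) auto
    also have "\<dots> = \<bar>weight p y * f y\<bar> * (1 + y ^ p)"
      using weight_pos[OF y, of p] by (simp add: abs_mult)
    also have "\<dots> \<le> B * (1 + y ^ p)" using B[OF y] y by (intro mult_right_mono) auto
    finally show "\<bar>f y\<bar> \<le> B * (1 + y ^ p)" by simp
  qed
qed

text \<open>
  This makes the suprema in both moduli finite: the weight changes only by a bounded factor under
  shifts of bounded length.
\<close>

lemma weighted_C_shift_bound:
  assumes "f \<in> weighted_C p" "0 \<le> c"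
  obtains B where "\<And>y t. 0 \<le> y \<Longrightarrow> 0 \<le> t \<Longrightarrow> t \<le> y + c \<Longrightarrow> weight p y * \<bar>f t\<bar> \<le> B"
proof -
  obtain B where B: "0 \<le> B" "\<And>y. 0 \<le> y \<Longrightarrow> \<bar>f y\<bar> \<le> B * (1 + y ^ p)"
    using weighted_C_growth[OF assms(1)] by blast
  show thesis
  proof
    fix y t :: real assume yt: "0 \<le> y" "0 \<le> t" "t \<le> y + c"
    have "\<bar>f t\<bar> \<le> B * (2 * (1 + c) ^ p * (1 + y ^ p))"
      using B(2)[of t] mult_left_mono[OF power_shift_le[of y c t p] B(1)] yt assms(2) by linarith
    then have "weight p y * \<bar>f t\<bar> \<le> weight p y * (B * (2 * (1 + c) ^ p * (1 + y ^ p)))"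
      using weight_pos[of y p] yt by (intro mult_left_mono) auto
    also have "\<dots> = B * (2 * (1 + c) ^ p) * (weight p y * (1 + y ^ p))" by simp
    also have "\<dots> \<le> B * (2 * (1 + c) ^ p) * 2"
      using weight_power_bounds(2)[OF yt(1)] B(1) assms(2) by (intro mult_left_mono) auto
    finally show "weight p y * \<bar>f t\<bar> \<le> B * (2 * (1 + c) ^ p) * 2" .
  qed
qed

lemma modulus1_upper:
  assumes f: "f \<in> weighted_C p" and "\<bar>t - y\<bar> \<le> \<delta>" "0 \<le> t" "0 \<le> y"
  shows "weight p y * \<bar>f t - f y\<bar> \<le> modulus1 p f \<delta>"
proof -
  have "0 \<le> \<delta>" using assms by linarith
  then obtain B where B: "\<And>y t. 0 \<le> y \<Longrightarrow> 0 \<le> t \<Longrightarrow> t \<le> y + \<delta> \<Longrightarrow> weight p y * \<bar>f t\<bar> \<le> B"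
    using weighted_C_shift_bound[OF f] by blast
  have "weight p y * \<bar>f t - f y\<bar> \<le> B + B" if "\<bar>t - y\<bar> \<le> \<delta>" "0 \<le> t" "0 \<le> y" for t y
  proof -
    have "weight p y * \<bar>f t - f y\<bar> \<le> weight p y * (\<bar>f t\<bar> + \<bar>f y\<bar>)"
      using weight_pos[of y p] that by (intro mult_left_mono) auto
    also have "\<dots> \<le> B + B"
      using B[of y t] B[of y y] that \<open>0 \<le> \<delta>\<close> by (simp add: distrib_left abs_le_iff)
    finally show ?thesis .
  qed
  then show ?thesis unfolding modulus1_def
    by (intro cSup_upper bdd_aboveI[of _ "B + B"]) (use assms in auto)
qed

lemma modulus2_upper:
  assumes f: "f \<in> weighted_C p" and s: "0 < s" "s \<le> \<delta>" and y: "0 \<le> y"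
  shows "weight p y * \<bar>second_difference s f y\<bar> \<le> modulus2 p f \<delta>"
proof -
  have "0 \<le> 2 * \<delta>" using s by simp
  then obtain B where B: "\<And>y t. 0 \<le> y \<Longrightarrow> 0 \<le> t \<Longrightarrow> t \<le> y + 2 * \<delta> \<Longrightarrow> weight p y * \<bar>f t\<bar> \<le> B"
    using weighted_C_shift_bound[OF f] by blast
  have bound: "weight p y * \<bar>second_difference s f y\<bar> \<le> 4 * B" if "0 < s" "s \<le> \<delta>" "0 \<le> y" for s y
  proof -
    have "weight p y * \<bar>second_difference s f y\<bar>
            \<le> weight p y * (\<bar>f (y + 2 * s)\<bar> + 2 * \<bar>f (y + s)\<bar> + \<bar>f y\<bar>)"
      using weight_pos[of y p] that by (intro mult_left_mono) (auto simp: second_difference_def)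
    also have "\<dots> \<le> 4 * B"
      using B[of y "y + 2 * s"] B[of y "y + s"] B[of y y] that by (simp add: distrib_left)
    finally show ?thesis .
  qed
  have "weight p y * \<bar>second_difference s f y\<bar> \<le> weighted_norm p (second_difference s f)"
    unfolding weighted_norm_def
    by (rule cSUP_upper) (use y s bound in \<open>auto intro!: bdd_aboveI[of _ "4 * B"]\<close>)
  also have "\<dots> \<le> modulus2 p f \<delta>" unfolding modulus2_def
  proof (rule cSUP_upper)
    have "weighted_norm p (second_difference s f) \<le> 4 * B" if "s \<in> {0<..\<delta>}" for s
      unfolding weighted_norm_def by (rule cSUP_least) (use that bound in auto)
    then show "bdd_above ((\<lambda>h. weighted_norm p (second_difference h f)) ` {0<..\<delta>})"
      by (auto intro!: bdd_aboveI[of _ "4 * B"])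
  qed (use s in auto)
  finally show ?thesis .
qed

section \<open>The gamma operator as an expectation\<close>

text \<open>
  The Beta integral. Writing \<open>t = (x + t) - x\<close> in the numerator expresses the integrand with
  \<open>t ^ (a + 1)\<close> as a difference of two integrands with \<open>t ^ a\<close>, so induction on \<open>a\<close> leaves only
  an integral with an elementary antiderivative.
\<close>

lemma beta_integral_halfline:
  fixes x :: real
  assumes x: "0 < x"
  shows "has_bochner_integral lborel (\<lambda>t. indicator {0..} t * (t ^ a / (x + t) ^ (a + c + 2)))
           (fact a * fact c / (fact (a + c + 1) * x ^ (c + 1)))"
proof (induction a arbitrary: c)
  case 0
  have "((\<lambda>t. - 1 / (real (c + 1) * (x + t) ^ (c + 1))) \<longlongrightarrow> 0) at_top"
  proof -
    have "filterlim (\<lambda>t. real (c + 1) * (x + t) ^ (c + 1)) at_top at_top"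
      by (intro filterlim_tendsto_pos_mult_at_top[OF tendsto_const] filterlim_pow_at_top
            filterlim_tendsto_add_at_top[OF tendsto_const] filterlim_ident) auto
    then show ?thesis by (intro real_tendsto_divide_at_top[OF tendsto_const])
  qed
  moreover have "((\<lambda>t. - 1 / (real (c + 1) * (x + t) ^ (c + 1)))
       has_real_derivative 1 / (x + t) ^ (c + 2)) (at t)" if "0 \<le> t" for t
  proof -
    define u q where "u = x + t" and "q = real (c + 1)"
    have uq: "0 < u" "0 < q" using x that by (auto simp: u_def q_def)
    have "((\<lambda>t. (x + t) ^ (c + 1)) has_real_derivative q * u ^ c) (at t)"
      unfolding u_def q_def
      by (auto intro!: derivative_eq_intros) (cases c; simp add: algebra_simps)
    then have "((\<lambda>t. (- 1 / q) * inverse ((x + t) ^ (c + 1))) has_real_derivative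
        (- 1 / q) * - (inverse (u ^ (c + 1)) * (q * u ^ c) * inverse (u ^ (c + 1)))) (at t)"
      unfolding u_def by (intro DERIV_cmult DERIV_inverse') (use uq in \<open>auto simp: u_def\<close>)
    moreover have "(- 1 / q) * - (inverse (u ^ (c + 1)) * (q * u ^ c) * inverse (u ^ (c + 1)))
        = 1 / u ^ (c + 2)"
      using uq by (simp add: field_simps)
    moreover have "(- 1 / q) * inverse z = - 1 / (q * z)" for z
      by (simp add: divide_inverse)
    ultimately show ?thesis by (simp only: u_def q_def)
  qed
  ultimately have "(\<integral>\<^sup>+t. ennreal (1 / (x + t) ^ (c + 2)) * indicator {0..} t \<partial>lborel)
       = ennreal (0 - (- 1 / (real (c + 1) * (x + 0) ^ (c + 1))))"
    using x by (intro nn_integral_FTC_atLeast) auto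
  then have "(\<integral>\<^sup>+t. ennreal (indicator {0..} t * (1 / (x + t) ^ (c + 2))) \<partial>lborel)
       = ennreal (1 / (real (c + 1) * x ^ (c + 1)))"
    by (simp add: indicator_mult_ennreal mult.commute)
  then have "has_bochner_integral lborel (\<lambda>t. indicator {0..} t * (1 / (x + t) ^ (c + 2)))
       (1 / (real (c + 1) * x ^ (c + 1)))"
    using x by (intro has_bochner_integral_nn_integral) (auto simp: indicator_def)
  moreover have "fact (c + 1) = real (c + 1) * fact c" by simp
  ultimately show ?case by simp
next
  case (Suc a)
  have "has_bochner_integral lborel
     (\<lambda>t. indicator {0..} t * (t ^ a / (x + t) ^ (a + c + 2))
        - x * (indicator {0..} t * (t ^ a / (x + t) ^ (a + Suc c + 2))))
     (fact a * fact c / (fact (a + c + 1) * x ^ (c + 1))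
        - x * (fact a * fact (Suc c) / (fact (a + Suc c + 1) * x ^ (Suc c + 1))))"
    by (intro has_bochner_integral_diff has_bochner_integral_mult_right Suc.IH)
  moreover have "indicator {0..} t * (t ^ a / (x + t) ^ (a + c + 2))
        - x * (indicator {0..} t * (t ^ a / (x + t) ^ (a + Suc c + 2)))
      = indicator {0..} t * (t ^ Suc a / (x + t) ^ (Suc a + c + 2))" for t
  proof (cases "0 \<le> t")
    case True
    have "P / U - x * (P / ((x + t) * U)) = t * P / ((x + t) * U)" if "U \<noteq> 0" for P U :: real
    proof -
      have "x + t \<noteq> 0" using True x by simp
      then show ?thesis using that by (simp add: divide_simps) (simp add: algebra_simps)
    qed
    then show ?thesis using True x by simp
  qed simp
  moreover have "fact a * fact c / (fact (a + c + 1) * x ^ (c + 1))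
        - x * (fact a * fact (Suc c) / (fact (a + Suc c + 1) * x ^ (Suc c + 1)))
      = fact (Suc a) * fact c / (fact (Suc a + c + 1) * x ^ (c + 1))"
  proof -
    have *: "fact (a + Suc c + 1) = (real a + real c + 2) * fact (a + c + 1)"
      "fact (Suc a + c + 1) = (real a + real c + 2) * fact (a + c + 1)"
      "fact (Suc c) = (real c + 1) * fact c" "fact (Suc a) = (real a + 1) * fact a"
      "x ^ (Suc c + 1) = x * x ^ (c + 1)"
      by (simp_all add: algebra_simps)
    have split: "A * C / (F * y) - x * (A * (c' * C) / (q * F * (x * y))) = a' * A * C / (q * F * y)"
      if "q = a' + c'" "q \<noteq> 0" "F \<noteq> 0" "y \<noteq> 0" for A C F y q a' c' :: real
      using that x by (simp add: divide_simps) (simp add: algebra_simps)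
    show ?thesis unfolding * by (rule split) (use x in auto)
  qed
  ultimately show ?case by simp
qed


definition gamma_density :: "nat \<Rightarrow> nat \<Rightarrow> real \<Rightarrow> real \<Rightarrow> real" where
  "gamma_density n k x t = indicator {0..} t *
     (fact (2 * n - k + 1) * x ^ (n + 1) / (fact n * fact (n - k)) *
      (t ^ (n - k) / (x + t) ^ (2 * n - k + 2)))"

definition gamma_measure :: "nat \<Rightarrow> nat \<Rightarrow> real \<Rightarrow> real measure" where
  "gamma_measure n k x = density lborel (\<lambda>t. ennreal (gamma_density n k x t))"

text \<open>The \<open>m\<close>-th moment at \<open>x = 1\<close>; at general \<open>x\<close> it scales by \<open>x ^ m\<close>.\<close>

definition moment :: "nat \<Rightarrow> nat \<Rightarrow> nat \<Rightarrow> real" where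
  "moment n k m = fact (n - k + m) * fact (n - m) / (fact (n - k) * fact n)"

lemma gamma_density_nonneg: "0 < x \<Longrightarrow> 0 \<le> gamma_density n k x t"
  by (auto simp: gamma_density_def indicator_def)

lemma gamma_density_measurable [measurable]: "gamma_density n k x \<in> borel_measurable borel"
  unfolding gamma_density_def by measurable

lemma sets_gamma_measure [measurable_cong, simp]: "sets (gamma_measure n k x) = sets borel"
  by (simp add: gamma_measure_def)

lemma AE_gamma_measure: "AE t in gamma_measure n k x. 0 \<le> t"
  unfolding gamma_measure_def
  by (subst AE_density) (auto simp: gamma_density_def indicator_def)

text \<open>
  Composition with \<open>max 0\<close> extends \<open>f\<close> continuously from \<open>[0,\<infinity>)\<close>, so that the integrand is
  measurable whatever \<open>f\<close> does on negative arguments.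
\<close>

lemma gamma_operator_eq_integral:
  assumes x: "0 < x" and f: "continuous_on {0..} f"
  shows "gamma_operator n k f x = (\<integral>t. f (max 0 t) \<partial>gamma_measure n k x)"
proof -
  define c where "c = fact (2 * n - k + 1) * x ^ (n + 1) / (fact n * fact (n - k))"
  have "continuous_on UNIV (\<lambda>t. f (max 0 t))"
    by (intro continuous_on_compose2[OF f] continuous_intros) auto
  then have "(\<lambda>t. f (max 0 t)) \<in> borel_measurable borel"
    by (rule borel_measurable_continuous_onI)
  then have "(\<integral>t. f (max 0 t) \<partial>gamma_measure n k x)
      = (\<integral>t. gamma_density n k x t * f (max 0 t) \<partial>lborel)"
    unfolding gamma_measure_def using gamma_density_nonneg[OF x]
    by (subst integral_real_density) auto
  also have "\<dots> = (\<integral>t. c * (indicator {0..} t *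
      (t ^ (n - k) / (x + t) ^ (2 * n - k + 2) * f t)) \<partial>lborel)"
    by (intro Bochner_Integration.integral_cong) (auto simp: gamma_density_def c_def indicator_def)
  also have "\<dots> = gamma_operator n k f x"
    by (simp only: gamma_operator_def set_lebesgue_integral_def c_def integral_mult_right_zero
        real_scaleR_def)
  finally show ?thesis by simp
qed

lemma has_moment_gamma_measure:
  assumes x: "0 < x" and k: "k \<le> n" and m: "m \<le> n"
  shows "has_bochner_integral (gamma_measure n k x) (\<lambda>t. t ^ m) (x ^ m * moment n k m)"
proof -
  define c where "c = fact (2 * n - k + 1) * x ^ (n + 1) / (fact n * fact (n - k))"
  have exps: "n - k + m + (n - m) + 2 = 2 * n - k + 2" "n - k + m + (n - m) + 1 = 2 * n - k + 1"
    using k m by auto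
  have "has_bochner_integral lborel
     (\<lambda>t. c * (indicator {0..} t * (t ^ (n - k + m) / (x + t) ^ (2 * n - k + 2))))
     (c * (fact (n - k + m) * fact (n - m) / (fact (2 * n - k + 1) * x ^ (n - m + 1))))"
    using has_bochner_integral_mult_right[OF beta_integral_halfline[OF x, of "n - k + m" "n - m"]]
    unfolding exps by blast
  moreover have "c * (fact (n - k + m) * fact (n - m) / (fact (2 * n - k + 1) * x ^ (n - m + 1)))
      = x ^ m * moment n k m"
  proof -
    have "x ^ (n + 1) = x ^ m * x ^ (n - m + 1)" using m by (simp flip: power_add)
    then show ?thesis using x by (simp add: c_def moment_def)
  qed
  moreover have "c * (indicator {0..} t * (t ^ (n - k + m) / (x + t) ^ (2 * n - k + 2)))
      = gamma_density n k x t *\<^sub>R t ^ m" for t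
    by (simp add: gamma_density_def c_def power_add)
  ultimately show ?thesis
    unfolding gamma_measure_def using gamma_density_nonneg[OF x]
    by (intro has_bochner_integral_density) auto
qed

section \<open>Estimates for moments\<close>

lemma moment_0: "moment n k 0 = 1"
  by (simp add: moment_def)

lemma moment_Suc:
  assumes "m < n"
  shows "moment n k (Suc m) = moment n k m * (real (n - k + m + 1) / real (n - m))"
proof -
  have facts: "fact (n - m) = real (n - m) * fact (n - Suc m)"
    "fact (n - k + Suc m) = real (n - k + m + 1) * fact (n - k + m)"
    using assms by (metis Suc_diff_Suc fact_Suc) simp
  have "x * P * A / D = P * (d * A) / D * (x / d)" if "d \<noteq> 0" for x P A D d :: real
    using that by simp
  then show ?thesis unfolding moment_def facts using assms by simp
qed

lemma moment_nonneg: "0 \<le> moment n k m"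
  by (simp add: moment_def)

lemma moment_ratio_le:
  assumes "m + 1 \<le> n - k" "k \<le> n" "1 \<le> k" "m \<le> p + 1"
  shows "real (n - k + m + 1) / real (n - m) \<le> 2 * real p + 3"
proof -
  have "n - k + m + 1 \<le> (n - m) + 2 * (p + 1)" "1 \<le> n - m" using assms by auto
  then have "n - k + m + 1 \<le> (n - m) + 2 * (p + 1) * (n - m)"
    by (metis add_le_cancel_left le_trans mult.right_neutral mult_le_mono2)
  then have "n - k + m + 1 \<le> (2 * p + 3) * (n - m)" by (simp add: algebra_simps)
  then have "real (n - k + m + 1) \<le> real ((2 * p + 3) * (n - m))" by (rule of_nat_mono)
  moreover have "0 < real (n - m)" using \<open>1 \<le> n - m\<close> by simp
  ultimately show ?thesis 
    by (simp add: pos_divide_le_eq del: of_nat_diff of_nat_add) (simp only: of_nat_mult of_nat_add of_nat_numeral)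
qed

lemma moment_le:
  assumes "p + 2 \<le> n - k" "k \<le> n" "1 \<le> k"
  shows "m \<le> p + 2 \<Longrightarrow> moment n k m \<le> (2 * real p + 3) ^ m"
proof (induction m)
  case 0
  then show ?case by (simp add: moment_0)
next
  case (Suc m)
  then have "moment n k m * (real (n - k + m + 1) / real (n - m))
      \<le> (2 * real p + 3) ^ m * (2 * real p + 3)"
    using assms moment_nonneg moment_ratio_le[of m n k p] by (intro mult_mono) auto
  moreover have "moment n k (Suc m) = moment n k m * (real (n - k + m + 1) / real (n - m))"
    using Suc.prems assms by (intro moment_Suc) auto
  ultimately show ?case by (simp only: power_Suc2)
qed

text \<open>
  This is \<open>x ^ (-m - 2)\<close> times the integral of \<open>t ^ m (t - e)\<^sup>2\<close>, \<open>e = c x\<close>. With \<open>r\<^sub>1\<close>, \<open>r\<^sub>2\<close>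
  the quotients of consecutive moments, it equals the \<open>m\<close>-th moment times
  \<open>(r\<^sub>1 - c)\<^sup>2 + r\<^sub>1 (r\<^sub>2 - r\<^sub>1)\<close>. Both \<open>r\<^sub>1\<close> and \<open>r\<^sub>2\<close> differ from \<open>c\<close> by \<open>O(1 / n)\<close>; this is
  where the rate of approximation comes from.
\<close>

lemma central_moment_le:
  assumes n: "p + 2 \<le> n - k" "k \<le> n" "1 \<le> k" and m: "m \<le> p"
  defines "c \<equiv> real (n - k + 1) / real n"
  shows "moment n k (m + 2) - 2 * c * moment n k (m + 1) + c\<^sup>2 * moment n k m
           \<le> 2 * (2 * real p + 3) ^ (p + 4) / real n"
proof -
  define q where "q = 2 * real p + 3"
  define r1 where "r1 = real (n - k + m + 1) / real (n - m)"
  define r2 where "r2 = real (n - k + m + 2) / real (n - (m + 1))"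
  have q: "3 \<le> q" by (simp add: q_def)
  define N K M where "N = real n" and "K = real k" and "M = real m"
  have conv: "real (n - k + m + 1) = N - K + M + 1" "real (n - k + m + 2) = N - K + M + 2"
    "real (n - k + 1) = N - K + 1" "real (n - m) = N - M" "real (n - (m + 1)) = N - M - 1"
    "real n = N"
    using n m by (auto simp: N_def K_def M_def of_nat_diff)
  have NKM: "M + K + 2 \<le> N" "1 \<le> K" "0 \<le> M" "M \<le> real p" "real p + K + 2 \<le> N"
    using n m by (auto simp: N_def K_def M_def)
  have "0 < N - M" "0 < N - M - 1" "0 < N" using NKM by auto
  have m1: "moment n k (m + 1) = moment n k m * r1"
    using n m by (simp add: moment_Suc r1_def)
  have m2: "moment n k (m + 2) = moment n k m * r1 * r2"
    using n m by (simp add: moment_Suc r1_def r2_def)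
  \<comment> \<open>The next two bounds let \<open>N\<close> replace the denominators \<open>N - M\<close> and \<open>N - M - 1\<close>.\<close>
  have den1: "N \<le> (real p + 1) * (N - M)"
  proof -
    have "M * 1 \<le> real p * (N - M)" using NKM by (intro mult_mono) auto
    then show ?thesis by (simp add: algebra_simps)
  qed
  have den2: "N \<le> (real p + 2) * (N - M - 1)"
  proof -
    have "(M + 1) * 1 \<le> (real p + 1) * (N - M - 1)" using NKM by (intro mult_mono) auto
    then show ?thesis by (simp add: algebra_simps)
  qed
  have r1c: "r1 - c = M * (2 * N - K + 1) / (N * (N - M))"
    using \<open>0 < N\<close> \<open>0 < N - M\<close> unfolding r1_def c_def conv
    by (simp add: field_simps)
  have "0 \<le> r1 - c"
    unfolding r1c using NKM by (intro divide_nonneg_pos mult_nonneg_nonneg mult_pos_pos) auto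
  moreover have "r1 - c \<le> q\<^sup>2 / N"
  proof -
    have "M * (2 * N - K + 1) \<le> real p * (2 * N)" using NKM by (intro mult_mono) auto
    also have "\<dots> \<le> real p * (2 * ((real p + 1) * (N - M)))"
      using den1 by (intro mult_left_mono) auto
    also have "\<dots> = (2 * real p * (real p + 1)) * (N - M)" by simp
    also have "\<dots> \<le> q\<^sup>2 * (N - M)"
      using \<open>0 < N - M\<close> by (intro mult_right_mono) (auto simp: q_def power2_eq_square algebra_simps)
    finally have "M * (2 * N - K + 1) / (N - M) \<le> q\<^sup>2"
      using \<open>0 < N - M\<close> by (simp add: pos_divide_le_eq)
    then have "M * (2 * N - K + 1) / (N - M) / N \<le> q\<^sup>2 / N"
      using \<open>0 < N\<close> by (intro divide_right_mono) auto
    then show ?thesis unfolding r1c by (simp add: mult.commute)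
  qed
  moreover have "r1 - c \<le> q\<^sup>2"
  proof -
    have "1 \<le> N" "0 \<le> q\<^sup>2" using NKM by auto
    then have "q\<^sup>2 / N \<le> q\<^sup>2 / 1" by (intro divide_left_mono) auto
    with \<open>r1 - c \<le> q\<^sup>2 / N\<close> show ?thesis by simp
  qed
  ultimately have sq: "(r1 - c)\<^sup>2 \<le> q ^ 4 / N"
  proof -
    assume *: "0 \<le> r1 - c" "r1 - c \<le> q\<^sup>2 / N" "r1 - c \<le> q\<^sup>2"
    then have "(r1 - c) * (r1 - c) \<le> q\<^sup>2 * (q\<^sup>2 / N)" by (intro mult_mono) auto
    then show ?thesis by (simp add: power2_eq_square eval_nat_numeral)
  qed
  have r21: "r2 - r1 = (2 * N - K + 1) / ((N - M) * (N - M - 1))"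
    using \<open>0 < N - M - 1\<close> \<open>0 < N - M\<close> unfolding r1_def r2_def conv
    by (simp add: field_simps)
  have "r2 - r1 \<le> q ^ 3 / N"
  proof -
    have "(2 * N - K + 1) * N \<le> 2 * (N * N)" using NKM by (simp add: algebra_simps mult_mono)
    also have "\<dots> \<le> 2 * (((real p + 1) * (N - M)) * ((real p + 2) * (N - M - 1)))"
      using den1 den2 NKM by (intro mult_left_mono mult_mono) auto
    also have "\<dots> = (2 * (real p + 1) * (real p + 2)) * ((N - M) * (N - M - 1))" by simp
    also have "\<dots> \<le> q ^ 3 * ((N - M) * (N - M - 1))"
    proof (rule mult_right_mono)
      have "2 * (real p + 1) * (real p + 2) \<le> q * q"
        by (auto simp: q_def algebra_simps)
      also have "\<dots> \<le> q ^ 3" using q by (simp add: eval_nat_numeral)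
      finally show "2 * (real p + 1) * (real p + 2) \<le> q ^ 3" .
    qed (use NKM in auto)
    finally have "(2 * N - K + 1) * N \<le> q ^ 3 * ((N - M) * (N - M - 1))" .
    moreover have "X / Y \<le> Q / N" if "X * N \<le> Q * Y" "0 < Y" for X Y Q
      using that \<open>0 < N\<close> by (simp add: field_simps)
    ultimately show ?thesis unfolding r21 using \<open>0 < N - M\<close> \<open>0 < N - M - 1\<close> by simp
  qed
  moreover have "r1 \<le> q" "0 \<le> r1"
    using moment_ratio_le[of m n k p] n m by (auto simp: r1_def q_def)
  moreover have "0 \<le> q ^ 3 / N" using q NKM by simp
  ultimately have "r1 * (r2 - r1) \<le> q * (q ^ 3 / N)"
    by (meson mult_left_mono mult_right_mono order_trans)
  then have "r1 * (r2 - r1) \<le> q ^ 4 / N" by (simp add: eval_nat_numeral)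
  with sq have "(r1 - c)\<^sup>2 + r1 * (r2 - r1) \<le> 2 * q ^ 4 / N" by simp
  moreover have "moment n k m \<le> q ^ p"
  proof -
    have "moment n k m \<le> q ^ m" using moment_le[OF n, of m] m by (simp add: q_def)
    also have "\<dots> \<le> q ^ p" using m q by (intro power_increasing) auto
    finally show ?thesis .
  qed
  moreover have "0 \<le> 2 * q ^ 4 / N" using q NKM by simp
  ultimately have "moment n k m * ((r1 - c)\<^sup>2 + r1 * (r2 - r1)) \<le> q ^ p * (2 * q ^ 4 / N)"
    using moment_nonneg[of n k m] by (meson mult_left_mono mult_right_mono order_trans)
  moreover have "moment n k m * ((r1 - c)\<^sup>2 + r1 * (r2 - r1))
     = moment n k (m + 2) - 2 * c * moment n k (m + 1) + c\<^sup>2 * moment n k m"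
    unfolding m1 m2 by (simp add: power2_eq_square algebra_simps)
  moreover have "q ^ p * (2 * q ^ 4 / N) = 2 * q ^ (p + 4) / N" by (simp add: power_add)
  ultimately show ?thesis unfolding q_def N_def by linarith
qed


text \<open>
  One half of the constant absorbs the moment of order \<open>m\<close>, the other half the central moment.
\<close>

definition gamma_constant :: "nat \<Rightarrow> real" where
  "gamma_constant p = 4 * (2 * real p + 3) ^ (p + 4)"

lemma gamma_constant_ge: "m \<le> p \<Longrightarrow> (2 * real p + 3) ^ m \<le> gamma_constant p / 2"
proof -
  assume "m \<le> p"
  then have "(2 * real p + 3) ^ m \<le> (2 * real p + 3) ^ (p + 4)" by (intro power_increasing) auto
  moreover have "0 \<le> (2 * real p + 3) ^ (p + 4)" by simp
  ultimately show ?thesis unfolding gamma_constant_def by linarith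
qed

lemma gamma_constant_ge_1: "1 \<le> gamma_constant p"
  using gamma_constant_ge[of 0 p] by simp

lemma gamma_measure_mass:
  fixes c :: real
  assumes "0 < x" "k \<le> n"
  shows "has_bochner_integral (gamma_measure n k x) (\<lambda>t. c) c"
  using has_bochner_integral_mult_right[OF has_moment_gamma_measure[of x k n 0], of c] assms
  by (simp add: moment_0)

lemma gamma_measure_mean:
  assumes "0 < x" "k \<le> n" "0 < n"
  shows "has_bochner_integral (gamma_measure n k x) (\<lambda>t. t - x * (real (n - k + 1) / real n)) 0"
proof -
  have "moment n k 1 = real (n - k + 1) / real n"
    using moment_Suc[of 0 n k] assms by (simp add: moment_0)
  moreover have "has_bochner_integral (gamma_measure n k x)
      (\<lambda>t. t ^ 1 - x * moment n k 1) (x ^ 1 * moment n k 1 - x * moment n k 1)"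
    using assms
    by (intro has_bochner_integral_diff has_moment_gamma_measure gamma_measure_mass) auto
  ultimately show ?thesis by simp
qed

lemma gamma_measure_power_le:
  assumes x: "0 < x" and n: "p + 2 \<le> n - k" "k \<le> n" "1 \<le> k" and m: "m \<le> p"
  shows "(\<integral>t. t ^ m \<partial>gamma_measure n k x) \<le> gamma_constant p * x ^ m"
proof -
  have "(\<integral>t. t ^ m \<partial>gamma_measure n k x) = x ^ m * moment n k m"
    using has_moment_gamma_measure[OF x n(2), of m] n m by (simp add: has_bochner_integral_iff)
  also have "\<dots> \<le> x ^ m * gamma_constant p"
    using moment_le[OF n, of m] gamma_constant_ge[OF m] gamma_constant_ge_1[of p] x m
    by (intro mult_left_mono) auto
  finally show ?thesis by (simp add: mult.commute)
qed

text \<open>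
  On the scale \<open>x / sqrt n\<close> the squared deviation from the mean has bounded expectation, also in the
  presence of the power \<open>t ^ m\<close> that comes from the growth of the second differences.
\<close>

lemma gamma_measure_spread:
  assumes x: "0 < x" and n: "p + 2 \<le> n - k" "k \<le> n" "1 \<le> k" and m: "m \<le> p"
  defines "e \<equiv> x * (real (n - k + 1) / real n)"
  defines "S \<equiv> (\<lambda>t. (1 + ((t - e) / (x / sqrt (real n)))\<^sup>2) * t ^ m)"
  shows "integrable (gamma_measure n k x) S"
    and "(\<integral>t. S t \<partial>gamma_measure n k x) \<le> gamma_constant p * x ^ m"
proof -
  define c where "c = real (n - k + 1) / real n"
  have e: "e = x * c" by (simp add: e_def c_def)
  have n0: "0 < real n" using n by auto
  have S: "S t = t ^ m + real n / x\<^sup>2 * (t ^ (m + 2) - 2 * e * t ^ (m + 1) + e\<^sup>2 * t ^ m)" for t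
  proof -
    have "((t - e) / (x / sqrt (real n)))\<^sup>2 = real n / x\<^sup>2 * (t - e)\<^sup>2"
      using x n0 by (simp add: power_divide power_mult_distrib)
    moreover have "(1 + r * (t - e)\<^sup>2) * t ^ m
        = t ^ m + r * (t ^ (m + 2) - 2 * e * t ^ (m + 1) + e\<^sup>2 * t ^ m)" for r
      by (simp add: power2_eq_square algebra_simps)
    ultimately show ?thesis by (simp only: S_def)
  qed
  define L where "L = moment n k (m + 2) - 2 * c * moment n k (m + 1) + c\<^sup>2 * moment n k m"
  have "has_bochner_integral (gamma_measure n k x) S
     (x ^ m * moment n k m + real n / x\<^sup>2 * (x ^ (m + 2) * moment n k (m + 2)
        - 2 * e * (x ^ (m + 1) * moment n k (m + 1)) + e\<^sup>2 * (x ^ m * moment n k m)))"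
    unfolding S using x n m
    by (intro has_bochner_integral_add has_bochner_integral_diff has_bochner_integral_mult_right
          has_moment_gamma_measure) auto
  moreover have "x ^ m * moment n k m + real n / x\<^sup>2 * (x ^ (m + 2) * moment n k (m + 2)
        - 2 * e * (x ^ (m + 1) * moment n k (m + 1)) + e\<^sup>2 * (x ^ m * moment n k m))
      = x ^ m * (moment n k m + real n * L)"
    using x by (simp add: e L_def field_simps power2_eq_square)
  ultimately have S_int: "has_bochner_integral (gamma_measure n k x) S
      (x ^ m * (moment n k m + real n * L))" by simp
  then show "integrable (gamma_measure n k x) S" by (simp add: has_bochner_integral_iff)
  have "moment n k m \<le> gamma_constant p / 2"
    using moment_le[OF n, of m] gamma_constant_ge[OF m] m by simp
  moreover have "real n * L \<le> gamma_constant p / 2"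
    using central_moment_le[OF n m] n0
    by (simp add: L_def c_def gamma_constant_def pos_le_divide_eq mult.commute)
  ultimately have "x ^ m * (moment n k m + real n * L) \<le> x ^ m * gamma_constant p"
    using x by (intro mult_left_mono) auto
  then show "(\<integral>t. S t \<partial>gamma_measure n k x) \<le> gamma_constant p * x ^ m"
    using S_int by (simp add: has_bochner_integral_iff mult.commute)
qed

section \<open>The approximation error\<close>

lemma weighted_C_integrable:
  assumes f: "f \<in> weighted_C p" and x: "0 < x" and n: "p \<le> n" "k \<le> n"
  shows "integrable (gamma_measure n k x) (\<lambda>t. f (max 0 t))"
proof -
  obtain B where B: "\<And>y. 0 \<le> y \<Longrightarrow> \<bar>f y\<bar> \<le> B * (1 + y ^ p)"
    using weighted_C_growth[OF f] by blast
  have "integrable (gamma_measure n k x) (\<lambda>t. B * (1 + t ^ p))"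
    using has_moment_gamma_measure[OF x n(2,1)] gamma_measure_mass[OF x n(2)]
    by (intro integrable_mult_right Bochner_Integration.integrable_add)
       (auto simp: has_bochner_integral_iff)
  moreover have "continuous_on UNIV (\<lambda>t. f (max 0 t))"
    by (intro continuous_on_compose2[OF weighted_C_continuous[OF f]] continuous_intros) auto
  then have "(\<lambda>t. f (max 0 t)) \<in> borel_measurable (gamma_measure n k x)"
    using borel_measurable_continuous_onI by (simp cong: measurable_cong_sets)
  moreover have "AE t in gamma_measure n k x. norm (f (max 0 t)) \<le> norm (B * (1 + t ^ p))"
    using AE_gamma_measure
  proof eventually_elim
    case (elim t)
    then show ?case using B[OF elim] by (simp add: max_def)
  qed
  ultimately show ?thesis by (rule Bochner_Integration.integrable_bound)
qed

lemma gamma_measure_integral_abs_le: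
  fixes F R :: "real \<Rightarrow> real"
  assumes "integrable (gamma_measure n k x) F" "integrable (gamma_measure n k x) R"
    and "\<And>t. 0 \<le> t \<Longrightarrow> \<bar>F t\<bar> \<le> R t"
  shows "\<bar>\<integral>t. F t \<partial>gamma_measure n k x\<bar> \<le> (\<integral>t. R t \<partial>gamma_measure n k x)"
proof -
  have "\<bar>\<integral>t. F t \<partial>gamma_measure n k x\<bar> \<le> (\<integral>t. \<bar>F t\<bar> \<partial>gamma_measure n k x)"
    using integral_norm_bound[of "gamma_measure n k x" F] by simp
  also have "\<dots> \<le> (\<integral>t. R t \<partial>gamma_measure n k x)"
  proof (rule integral_mono_AE)
    show "AE t in gamma_measure n k x. \<bar>F t\<bar> \<le> R t"
      using AE_gamma_measure by eventually_elim (rule assms(3))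
  qed (use assms in auto)
  finally show ?thesis .
qed

text \<open>
  The Taylor estimate is integrated against the gamma measure. Its linear term disappears because it
  is centred at the mean.
\<close>

lemma gamma_operator_sub_mean_le:
  assumes f: "f \<in> weighted_C p" and x: "0 < x" and n: "p + 2 \<le> n - k" "k \<le> n" "1 \<le> k"
  shows "weight p x * \<bar>gamma_operator n k f x - f (x * (real (n - k + 1) / real n))\<bar>
     \<le> 16 * 2 ^ p * gamma_constant p * modulus2 p f (x / sqrt (real n))"
proof -
  define e h \<omega> C where "e = x * (real (n - k + 1) / real n)" and "h = x / sqrt (real n)"
    and "\<omega> = modulus2 p f h" and "C = gamma_constant p"
  define A where "A = (f (e + h) - f e) / h"
  define K where "K = 1 + 2 ^ p * (1 + x ^ p)"
  define S where "S = (\<lambda>m t. (1 + ((t - e) / h)\<^sup>2) * t ^ m)"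
  have n0: "1 \<le> real n" using n by auto
  have h: "0 < h" "h \<le> x" using x n0 by (auto simp: h_def divide_le_eq)
  have e: "0 \<le> e" "e \<le> x" using x n n0 by (auto simp: e_def divide_le_eq intro!: mult_left_le)
  have "0 \<le> weight p 0 * \<bar>second_difference h f 0\<bar>" using weight_pos[of 0 p] by simp
  then have \<omega>: "0 \<le> \<omega>" using modulus2_upper[OF f h(1) order_refl order_refl]
    by (simp add: \<omega>_def)
  have diff: "\<bar>second_difference s f y\<bar> \<le> \<omega> * (1 + y ^ p)" if "0 < s" "s \<le> h" "0 \<le> y" for s y
  proof -
    have "\<bar>second_difference s f y\<bar> * 1 \<le> \<bar>second_difference s f y\<bar> * (weight p y * (1 + y ^ p))"
      using weight_power_bounds(1)[OF that(3)] by (intro mult_left_mono) auto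
    also have "\<dots> = (weight p y * \<bar>second_difference s f y\<bar>) * (1 + y ^ p)" by simp
    also have "\<dots> \<le> \<omega> * (1 + y ^ p)"
      using modulus2_upper[OF f that] that(3) by (intro mult_right_mono) (auto simp: \<omega>_def)
    finally show ?thesis by simp
  qed
  have pointwise: "\<bar>f (max 0 t) - f e - A * (t - e)\<bar> \<le> 4 * \<omega> * (S p t + K * S 0 t)"
    if t: "0 \<le> t" for t
  proof -
    have "\<bar>f t - f e - A * (t - e)\<bar>
        \<le> 4 * (1 + ((t - e) / h)\<^sup>2) * (\<omega> * (1 + t ^ p) + \<omega> * (1 + (e + h) ^ p))"
      unfolding A_def using \<omega>
      by (intro second_difference_taylor weighted_C_continuous[OF f] h e t diff mult_left_mono)
         (auto intro!: power_mono)
    also have "\<dots> \<le> 4 * (1 + ((t - e) / h)\<^sup>2) * (\<omega> * (t ^ p + K))"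
    proof (rule mult_left_mono)
      \<comment> \<open>\<open>e\<close> and \<open>h\<close> are both at most \<open>x\<close>.\<close>
      have "(e + h) ^ p \<le> (2 * x) ^ p" using e h by (intro power_mono) auto
      moreover have "(2 * x) ^ p = 2 ^ p * x ^ p" by (rule power_mult_distrib)
      moreover have "(1::real) \<le> 2 ^ p" by simp
      ultimately have "1 + (e + h) ^ p \<le> 2 ^ p * (1 + x ^ p)" unfolding distrib_left by linarith
      then have "\<omega> * (1 + t ^ p + (1 + (e + h) ^ p)) \<le> \<omega> * (t ^ p + K)"
        using \<omega> by (intro mult_left_mono) (auto simp: K_def)
      then show "\<omega> * (1 + t ^ p) + \<omega> * (1 + (e + h) ^ p) \<le> \<omega> * (t ^ p + K)"
        by (simp only: distrib_left)
    qed auto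
    also have "\<dots> = 4 * \<omega> * (S p t + K * S 0 t)" by (simp add: S_def algebra_simps)
    finally show ?thesis using t by (simp add: max_def)
  qed
  have int_f: "integrable (gamma_measure n k x) (\<lambda>t. f (max 0 t))"
    using n by (intro weighted_C_integrable[OF f x]) auto
  have int_S: "integrable (gamma_measure n k x) (S m)"
    and S_le: "(\<integral>t. S m t \<partial>gamma_measure n k x) \<le> C * x ^ m" if "m \<le> p" for m
    using gamma_measure_spread[OF x n that] by (simp_all add: S_def e_def h_def C_def)
  have const: "integrable (gamma_measure n k x) (\<lambda>t. c)" "(\<integral>t. c \<partial>gamma_measure n k x) = c"
    for c :: real
    using gamma_measure_mass[OF x n(2), of c] unfolding has_bochner_integral_iff by blast+
  have mean: "integrable (gamma_measure n k x) (\<lambda>t. t - e)"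
    "(\<integral>t. t - e \<partial>gamma_measure n k x) = 0"
    using gamma_measure_mean[OF x n(2)] n0 unfolding has_bochner_integral_iff e_def by auto
  have rest: "integrable (gamma_measure n k x) (\<lambda>t. f (max 0 t) - f e - A * (t - e))"
    by (intro Bochner_Integration.integrable_diff integrable_mult_right int_f const mean)
  have "(\<integral>t. f (max 0 t) - f e - A * (t - e) \<partial>gamma_measure n k x)
      = gamma_operator n k f x - f e"
    using int_f const mean
    by (simp add: gamma_operator_eq_integral[OF x weighted_C_continuous[OF f]])
  then have "\<bar>gamma_operator n k f x - f e\<bar>
      = \<bar>\<integral>t. f (max 0 t) - f e - A * (t - e) \<partial>gamma_measure n k x\<bar>" by simp
  also have "\<dots> \<le> (\<integral>t. 4 * \<omega> * (S p t + K * S 0 t) \<partial>gamma_measure n k x)"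
    using int_S by (intro gamma_measure_integral_abs_le rest pointwise) auto
  also have "\<dots> = 4 * \<omega> * ((\<integral>t. S p t \<partial>gamma_measure n k x) + K * (\<integral>t. S 0 t \<partial>gamma_measure n k x))"
    using int_S by simp
  also have "\<dots> \<le> 4 * \<omega> * (C * x ^ p + K * (C * x ^ 0))"
    using S_le[of p] S_le[of 0] \<omega> x by (intro mult_left_mono add_mono) (auto simp: K_def)
  also have "\<dots> = 4 * \<omega> * C * (x ^ p + K)" by (simp add: algebra_simps)
  also have "\<dots> \<le> 4 * \<omega> * C * (2 * 2 ^ p * (1 + x ^ p))"
  proof (rule mult_left_mono)
    define Z where "Z = 2 ^ p * (1 + x ^ p)"
    have "1 * (1 + x ^ p) \<le> Z" unfolding Z_def using x by (intro mult_right_mono) auto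
    then have "x ^ p + (1 + Z) \<le> 2 * Z" by simp
    then show "x ^ p + K \<le> 2 * 2 ^ p * (1 + x ^ p)" by (simp only: K_def Z_def mult.assoc)
  qed (use \<omega> gamma_constant_ge_1[of p] in \<open>auto simp: C_def\<close>)
  finally have "\<bar>gamma_operator n k f x - f e\<bar> \<le> 8 * 2 ^ p * C * \<omega> * (1 + x ^ p)"
    by (simp add: mult_ac)
  then have "weight p x * \<bar>gamma_operator n k f x - f e\<bar>
      \<le> weight p x * (8 * 2 ^ p * C * \<omega> * (1 + x ^ p))"
    using weight_pos[of x p] x by (intro mult_left_mono) auto
  also have "\<dots> = 8 * 2 ^ p * C * \<omega> * (weight p x * (1 + x ^ p))" by simp
  also have "\<dots> \<le> 8 * 2 ^ p * C * \<omega> * 2"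
    using weight_power_bounds(2)[of x p] x \<omega> gamma_constant_ge_1[of p]
    by (intro mult_left_mono) (auto simp: C_def)
  finally show ?thesis by (simp add: e_def h_def \<omega>_def C_def mult_ac)
qed

lemma gamma_operator_error_le:
  assumes f: "f \<in> weighted_C p" and x: "0 < x" and n: "p + 2 \<le> n - k" "k \<le> n" "1 \<le> k"
  shows "weight p x * \<bar>gamma_operator n k f x - f x\<bar>
     \<le> 16 * 2 ^ p * gamma_constant p * modulus2 p f (x / sqrt (real n))
       + modulus1 p f (\<bar>1 - real k\<bar> / real n * x)"
proof -
  define e where "e = x * (real (n - k + 1) / real n)"
  have "0 < real n" using n by auto
  then have "e - x = (1 - real k) / real n * x" using n by (simp add: e_def field_simps of_nat_diff)
  then have "\<bar>e - x\<bar> = \<bar>1 - real k\<bar> / real n * x" using x by (simp add: abs_mult)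
  then have "weight p x * \<bar>f e - f x\<bar> \<le> modulus1 p f (\<bar>1 - real k\<bar> / real n * x)"
    using x by (intro modulus1_upper[OF f]) (auto simp: e_def)
  moreover have "weight p x * \<bar>gamma_operator n k f x - f x\<bar>
      \<le> weight p x * (\<bar>gamma_operator n k f x - f e\<bar> + \<bar>f e - f x\<bar>)"
    using weight_pos[of x p] x by (intro mult_left_mono) auto
  ultimately show ?thesis
    using gamma_operator_sub_mean_le[OF f x n] by (simp add: e_def distrib_left)
qed

text \<open>
  The operators are uniformly bounded in the weighted norm. This handles large \<open>x / sqrt n\<close>, where a
  Lipschitz condition at \<open>0\<close> says nothing about the second modulus.
\<close>

lemma gamma_operator_error_bounded:
  assumes f: "f \<in> weighted_C p"
  obtains B where "0 \<le> B" "\<And>n k x. p + 2 \<le> n - k \<Longrightarrow> k \<le> n \<Longrightarrow> 1 \<le> k \<Longrightarrow> 0 < x \<Longrightarrow>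
     weight p x * \<bar>gamma_operator n k f x - f x\<bar> \<le> B"
proof -
  obtain B where B: "0 \<le> B" "\<And>y. 0 \<le> y \<Longrightarrow> \<bar>f y\<bar> \<le> B * (1 + y ^ p)"
    using weighted_C_growth[OF f] by blast
  define C where "C = gamma_constant p"
  have C: "1 \<le> C" using gamma_constant_ge_1 by (simp add: C_def)
  show thesis
  proof
    show "0 \<le> 4 * B * C" using B C by simp
    fix n k :: nat and x :: real
    assume n: "p + 2 \<le> n - k" "k \<le> n" "1 \<le> k" and x: "0 < x"
    have pn: "p \<le> n" using n by simp
    have const: "integrable (gamma_measure n k x) (\<lambda>t. c)" "(\<integral>t. c \<partial>gamma_measure n k x) = c"
      for c :: real
      using gamma_measure_mass[OF x n(2), of c] unfolding has_bochner_integral_iff by blast+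
    have int_p: "integrable (gamma_measure n k x) (\<lambda>t. t ^ p)"
      using has_moment_gamma_measure[OF x n(2) pn] by (simp add: has_bochner_integral_iff)
    have "\<bar>gamma_operator n k f x\<bar> = \<bar>\<integral>t. f (max 0 t) \<partial>gamma_measure n k x\<bar>"
      by (simp add: gamma_operator_eq_integral[OF x weighted_C_continuous[OF f]])
    also have "\<dots> \<le> (\<integral>t. B * (1 + t ^ p) \<partial>gamma_measure n k x)"
      using B(2) const int_p
      by (intro gamma_measure_integral_abs_le weighted_C_integrable[OF f x pn n(2)]) (auto simp: max_def)
    also have "\<dots> = B * (1 + (\<integral>t. t ^ p \<partial>gamma_measure n k x))"
      using const int_p by simp
    also have "\<dots> \<le> B * (C + C * x ^ p)"
      using gamma_measure_power_le[OF x n order_refl] B(1) C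
      by (intro mult_left_mono add_mono) (auto simp: C_def)
    finally have "\<bar>gamma_operator n k f x\<bar> \<le> B * C * (1 + x ^ p)" by (simp add: algebra_simps)
    moreover have "\<bar>f x\<bar> \<le> B * C * (1 + x ^ p)"
    proof -
      have "B * (1 + x ^ p) * 1 \<le> B * (1 + x ^ p) * C" using B C x by (intro mult_left_mono) auto
      then show ?thesis using B(2)[of x] x by (simp add: mult_ac)
    qed
    ultimately have "\<bar>gamma_operator n k f x - f x\<bar> \<le> 2 * B * C * (1 + x ^ p)" by linarith
    then have "weight p x * \<bar>gamma_operator n k f x - f x\<bar>
        \<le> weight p x * (2 * B * C * (1 + x ^ p))"
      using weight_pos[of x p] x by (intro mult_left_mono) auto
    also have "\<dots> = 2 * B * C * (weight p x * (1 + x ^ p))" by simp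
    also have "\<dots> \<le> 2 * B * C * 2"
      using weight_power_bounds(2)[of x p] x B C by (intro mult_left_mono) auto
    finally show "weight p x * \<bar>gamma_operator n k f x - f x\<bar> \<le> 4 * B * C" by simp
  qed
qed

theorem theorem3:
  fixes p k :: nat
  assumes "k \<ge> 1"
  shows "(\<exists>N>0. \<forall>f\<in>weighted_C p. \<forall>n::nat. k \<le> n \<longrightarrow> p + 2 \<le> n - k \<longrightarrow> (\<forall>x>0.
            weight p x * \<bar>gamma_operator n k f x - f x\<bar>
              \<le> N * modulus2 p f (x / sqrt (real n))
                 + modulus1 p f (\<bar>1 - real k\<bar> / real n * x)))
       \<and> (\<forall>\<alpha>::real. \<forall>f. 0 < \<alpha> \<longrightarrow> \<alpha> \<le> 2 \<longrightarrow> f \<in> Lip2 p \<alpha> \<longrightarrow>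
            (\<exists>N>0. \<forall>n::nat. k \<le> n \<longrightarrow> p + 2 \<le> n - k \<longrightarrow> (\<forall>x>0.
              weight p x * \<bar>gamma_operator n k f x - f x\<bar>
                \<le> N * (x\<^sup>2 / real n) powr (\<alpha> / 2)
                   + modulus1 p f (\<bar>1 - real k\<bar> / real n * x))))"
proof (intro conjI allI impI)
  define N where "N = 16 * 2 ^ p * gamma_constant p"
  have N: "0 < N" using gamma_constant_ge_1[of p] by (simp add: N_def)
  show "\<exists>N>0. \<forall>f\<in>weighted_C p. \<forall>n::nat. k \<le> n \<longrightarrow> p + 2 \<le> n - k \<longrightarrow> (\<forall>x>0.
            weight p x * \<bar>gamma_operator n k f x - f x\<bar>
              \<le> N * modulus2 p f (x / sqrt (real n))
                 + modulus1 p f (\<bar>1 - real k\<bar> / real n * x))"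
    using N gamma_operator_error_le assms unfolding N_def by blast
  fix \<alpha> :: real and f :: "real \<Rightarrow> real"
  assume \<alpha>: "0 < \<alpha>" and "f \<in> Lip2 p \<alpha>"
  then have f: "f \<in> weighted_C p" and O: "modulus2 p f \<in> O[at_right 0](\<lambda>\<delta>. \<delta> powr \<alpha>)"
    by (auto simp: Lip2_def)
  obtain c where c: "0 < c" and "\<forall>\<^sub>F \<delta> in at_right 0. norm (modulus2 p f \<delta>) \<le> c * norm (\<delta> powr \<alpha>)"
    using landau_o.bigE[OF O] by blast
  then obtain b where b: "0 < b"
    and small: "\<And>\<delta>. 0 < \<delta> \<Longrightarrow> \<delta> < b \<Longrightarrow> \<bar>modulus2 p f \<delta>\<bar> \<le> c * \<delta> powr \<alpha>"
    unfolding eventually_at_right_field by auto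
  obtain B where B: "0 \<le> B" "\<And>n k x. p + 2 \<le> n - k \<Longrightarrow> k \<le> n \<Longrightarrow> 1 \<le> k \<Longrightarrow> 0 < x \<Longrightarrow>
     weight p x * \<bar>gamma_operator n k f x - f x\<bar> \<le> B"
    using gamma_operator_error_bounded[OF f] by blast
  show "\<exists>N>0. \<forall>n::nat. k \<le> n \<longrightarrow> p + 2 \<le> n - k \<longrightarrow> (\<forall>x>0.
              weight p x * \<bar>gamma_operator n k f x - f x\<bar>
                \<le> N * (x\<^sup>2 / real n) powr (\<alpha> / 2)
                   + modulus1 p f (\<bar>1 - real k\<bar> / real n * x))"
  proof (intro exI conjI allI impI)
    \<comment> \<open>The first summand serves \<open>x / sqrt n < b\<close>, the second the remaining arguments.\<close>
    show "0 < N * c + B / b powr \<alpha>" using N c B b by (simp add: add_pos_nonneg)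
    fix n :: nat and x :: real
    assume n: "k \<le> n" "p + 2 \<le> n - k" and x: "0 < x"
    define \<delta> where "\<delta> = x / sqrt (real n)"
    define \<omega>1 where "\<omega>1 = modulus1 p f (\<bar>1 - real k\<bar> / real n * x)"
    have "0 < real n" using n by auto
    then have \<delta>: "0 < \<delta>" using x by (simp add: \<delta>_def)
    have "x\<^sup>2 / real n = \<delta> powr 2" using \<delta> by (simp add: \<delta>_def power_divide)
    then have rate: "(x\<^sup>2 / real n) powr (\<alpha> / 2) = \<delta> powr \<alpha>" by (simp add: powr_powr)
    have "weight p x * \<bar>f x - f x\<bar> \<le> \<omega>1"
      unfolding \<omega>1_def using x by (intro modulus1_upper[OF f]) auto
    then have \<omega>1: "0 \<le> \<omega>1" by simp
    have nonneg: "0 \<le> N * c * \<delta> powr \<alpha>" "0 \<le> B / b powr \<alpha> * \<delta> powr \<alpha>"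
      using N c B by auto
    have "weight p x * \<bar>gamma_operator n k f x - f x\<bar>
        \<le> N * c * \<delta> powr \<alpha> + B / b powr \<alpha> * \<delta> powr \<alpha> + \<omega>1"
    proof (cases "\<delta> < b")
      case True
      have "weight p x * \<bar>gamma_operator n k f x - f x\<bar> \<le> N * modulus2 p f \<delta> + \<omega>1"
        using gamma_operator_error_le[OF f x n(2,1) assms] by (simp add: N_def \<delta>_def \<omega>1_def)
      also have "N * modulus2 p f \<delta> \<le> N * (c * \<delta> powr \<alpha>)"
        using small[OF \<delta> True] N by (intro mult_left_mono) auto
      finally show ?thesis using nonneg by simp
    next
      case False
      have "weight p x * \<bar>gamma_operator n k f x - f x\<bar> \<le> B / b powr \<alpha> * b powr \<alpha>"
        using B(2)[OF n(2,1) assms x] b by simp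
      also have "\<dots> \<le> B / b powr \<alpha> * \<delta> powr \<alpha>"
        using False b B \<alpha> by (intro mult_left_mono powr_mono2) auto
      finally show ?thesis using nonneg \<omega>1 by linarith
    qed
    then show "weight p x * \<bar>gamma_operator n k f x - f x\<bar>
        \<le> (N * c + B / b powr \<alpha>) * (x\<^sup>2 / real n) powr (\<alpha> / 2)
          + modulus1 p f (\<bar>1 - real k\<bar> / real n * x)"
      unfolding rate \<omega>1_def by (simp add: distrib_right)
  qed
qed

end
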